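(* Let $[0,T]$ be divided into $L$ equal subintervals with $\Delta t=T/L$ and $t_j=j\Delta t$, $0\le j\le L$, and let $H(t)$, $t\in[0,T]$, be a (Hermitian, differentiable) time-dependent Hamiltonian with $\|H(t)\|\le\alpha$ for all $t\in[0,T]$. For each $0\le j\le L-1$ let $\alpha^j_{\mathrm{comm}},\beta^j_{\mathrm{comm}}$ be numbers with $$\sup_{\sigma,s,t\in[t_j,t_{j+1}]}\left\|\left[[H(\sigma),H(s)],H(t)\right]\right\|\le\alpha^j_{\mathrm{comm}},\qquad \sup_{\sigma,s,t,\tau\in[t_j,t_{j+1}]}\left\|\left[[H(\sigma),H(s)],[H(\tau),H(t)]\right]\right\|\le\beta^j_{\mathrm{comm}} .$$ Let $U_{\mathrm{exact}}(T,0)=\mathcal{T}e^{-i\int_0^TH(s)\,ds}$ be the exact long-time unitary, and let the quantum Magnus algorithm accounting for the numerical quadrature be $$\tilde U_2(T,0)=\tilde U_2(t_L,t_{L-1})\cdots\tilde U_2(t_2,t_1)\tilde U_2(t_1,t_0),\qquad \tilde U_2(t_{j+1},t_j)=e^{\tilde\Omega_2(t_{j+1},t_j)},$$ where $\tilde\Omega_2(t_{j+1},t_j)$ is the Riemann sum quadrature of the second-order Magnus exponent $\Omega_2(t_{j+1},t_j)$, and $M$ is the number of numerical quadrature points used in the Riemann sum. Then $$\left\|U_{\mathrm{exact}}(T,0)-\tilde U_2(T,0)\right\|\le\frac{13}{24}\Delta t^3\sum_{j=0}^{L-1}\alpha^j_{\mathrm{comm}}+\frac{5}{48}\Delta t^4\sum_{j=0}^{L-1}\beta^j_{\mathrm{comm}}+\frac{T\Delta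 t}{M}(1+3\Delta t\,\alpha)\sup_{s\in[0,T]}\|H'(s)\| .$$
   Context: $\|\cdot\|$ is the operator norm and $[X,Y]=XY-YX$. The time-ordered exponential $\mathcal{T}e^{-i\int_0^tH(s)ds}$ is the solution of $\partial_tU(t)=-iH(t)U(t)$, $U(0)=I$. The second-order Magnus exponent is $$\Omega_2(t_{j+1},t_j)=-i\int_{t_j}^{t_{j+1}}H(s)\,ds+\frac12\int_{t_j}^{t_{j+1}}\left[\int_{t_j}^{s}H(\sigma)\,d\sigma,\,H(s)\right]ds ,$$ and $\tilde\Omega_2(t_{j+1},t_j)$ denotes the same expression with the integrals replaced by Riemann sums with $M$ quadrature points. The superscript $j$ in $\alpha^j_{\mathrm{comm}},\beta^j_{\mathrm{comm}}$ is an index, not a power. *)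

theory Defs
  imports "HOL-Analysis.Analysis"
begin

definition hermitian :: "complex^'n^'n \<Rightarrow> bool" where
  "hermitian A \<longleftrightarrow> (\<forall>i j. A $ i $ j = cnj (A $ j $ i))"

(* The spectral norm; the type class norm of complex^'n^'n is the Frobenius norm instead. *)
definition opnorm :: "complex^'n^'n \<Rightarrow> real" where
  "opnorm A = onorm (\<lambda>v. A *v v)"

definition commutator :: "complex^'n^'n \<Rightarrow> complex^'n^'n \<Rightarrow> complex^'n^'n" where
  "commutator A B = A ** B - B ** A"

definition cscale :: "complex \<Rightarrow> complex^'n^'n \<Rightarrow> complex^'n^'n" where
  "cscale c A = (\<chi> i j. c * A $ i $ j)"

(* The library's exp does not apply: the class product on vectors is componentwise. *)
definition matrix_exp :: "complex^'n^'n \<Rightarrow> complex^'n^'n" where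
  "matrix_exp A = (\<Sum>n. (1 / fact n) *\<^sub>R (((**) A ^^ n) (mat 1)))"

definition is_time_ordered_exp ::
  "(real \<Rightarrow> complex^'n^'n) \<Rightarrow> real \<Rightarrow> (real \<Rightarrow> complex^'n^'n) \<Rightarrow> bool" where
  "is_time_ordered_exp H T U \<longleftrightarrow>
     U 0 = mat 1 \<and>
     (\<forall>t\<in>{0..T}. (U has_vector_derivative cscale (- \<i>) (H t ** U t)) (at t within {0..T}))"

definition magnus2 :: "(real \<Rightarrow> complex^'n^'n) \<Rightarrow> real \<Rightarrow> real \<Rightarrow> complex^'n^'n" where
  "magnus2 H b a =
     cscale (- \<i>) (integral {a..b} H)
     + (1 / 2) *\<^sub>R integral {a..b} (\<lambda>s. commutator (integral {a..s} H) (H s))"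

(* magnus2 with its integrals replaced by Riemann sums over M cells of equal length (b - a) / M,
   with sample points x 0, ..., x (M - 1), one in each cell.  The inner integral, taken up to
   s = x k, becomes the sum over the cells before the k-th one; a contribution of the k-th cell
   would be a multiple of H (x k) and hence would not change the commutator. *)
definition riemann_magnus2 ::
  "(real \<Rightarrow> complex^'n^'n) \<Rightarrow> nat \<Rightarrow> (nat \<Rightarrow> real) \<Rightarrow> real \<Rightarrow> real \<Rightarrow> complex^'n^'n" where
  "riemann_magnus2 H M x b a =
     (let \<delta> = (b - a) / real M in
       cscale (- \<i>) (\<Sum>k<M. \<delta> *\<^sub>R H (x k))
       + (1 / 2) *\<^sub>R (\<Sum>k<M. \<delta> *\<^sub>R commutator (\<Sum>l<k. \<delta> *\<^sub>R H (x l)) (H (x k))))"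

definition sample_points :: "nat \<Rightarrow> (nat \<Rightarrow> real) \<Rightarrow> real \<Rightarrow> real \<Rightarrow> bool" where
  "sample_points M x b a \<longleftrightarrow>
     (\<forall>k<M. x k \<in> {a + real k * ((b - a) / real M) .. a + real (Suc k) * ((b - a) / real M)})"

definition grid :: "real \<Rightarrow> nat \<Rightarrow> nat \<Rightarrow> real" where
  "grid T L j = real j * (T / real L)"

primrec ordered_prod :: "(nat \<Rightarrow> complex^'n^'n) \<Rightarrow> nat \<Rightarrow> complex^'n^'n" where
  "ordered_prod V 0 = mat 1"
| "ordered_prod V (Suc j) = V j ** ordered_prod V j"

(* \<xi> j k is the k-th sample point on the j-th time step. *)
definition magnus_algorithm ::
  "(real \<Rightarrow> complex^'n^'n) \<Rightarrow> real \<Rightarrow> nat \<Rightarrow> nat \<Rightarrow> (nat \<Rightarrow> nat \<Rightarrow> real) \<Rightarrow> complex^'n^'n" where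
  "magnus_algorithm H T L M \<xi> =
     ordered_prod
       (\<lambda>j. matrix_exp (riemann_magnus2 H M (\<xi> j) (grid T L (Suc j)) (grid T L j))) L"

end

theory Submission
  imports Defs
begin

text \<open>
  Write \<open>A = -iH\<close>, \<open>B(t) = \<integral> A\<close> from the left end of a time step to \<open>t\<close>, \<open>K = [B, A]\<close>,
  \<open>C = - \<integral> K / 2\<close> and \<open>\<Omega> = B + C\<close>, the Magnus exponent, so that \<open>\<Omega>' = A - K / 2\<close>. With \<open>N = [\<Omega>, K]\<close>
  we have \<open>[\<Omega>, \<Omega>'] = K + ([C, A] - N / 2)\<close>. Expanding the derivative of \<open>exp (- \<Omega>)\<close> to second
  order in \<open>K\<close> and only to first order in \<open>[C, A] - N / 2\<close>, the terms in \<open>K\<close> cancel and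
  \<open>exp (- \<Omega>) U\<close> has a derivative of norm at most \<open>\<parallel>N\<parallel> / 6 + \<parallel>[C, A] - N / 2\<parallel> / 2\<close>. Since
  \<open>N = [B, K] + [C, K]\<close>, only nested commutators of the two given shapes occur, and integration
  yields the constants 13/24 and 5/48. Exponentials of skew-adjoint elements are 1-Lipschitz,
  which gives the quadrature error, and everything is unitary, so the errors of the steps add up.
  The argument works in any unital C*-algebra.
\<close>

section \<open>Commutators and exponentials in Banach algebras\<close>

definition lie :: "'a::ring \<Rightarrow> 'a \<Rightarrow> 'a" where
  "lie x y = x * y - y * x"

lemma norm_lie_le: "norm (lie x y) \<le> 2 * norm x * norm (y :: 'a::real_normed_algebra)"
proof -
  have "norm (lie x y) \<le> norm (x * y) + norm (y * x)"
    unfolding lie_def by (rule norm_triangle_ineq4)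
  also have "\<dots> \<le> 2 * norm x * norm y"
    using norm_mult_ineq[of x y] norm_mult_ineq[of y x] by (simp add: mult_ac)
  finally show ?thesis .
qed

lemma bounded_bilinear_lie: "bounded_bilinear (lie :: 'a::real_normed_algebra \<Rightarrow> 'a \<Rightarrow> 'a)"
proof
  show "\<exists>K. \<forall>a b :: 'a. norm (lie a b) \<le> norm a * norm b * K"
    by (intro exI[of _ 2] allI order_trans[OF norm_lie_le]) (simp add: mult_ac)
qed (simp_all add: lie_def algebra_simps)

interpretation lie: bounded_bilinear "lie :: 'a::real_normed_algebra \<Rightarrow> 'a \<Rightarrow> 'a"
  by (rule bounded_bilinear_lie)

lemma lie_self [simp]: "lie x x = 0"
  and lie_anticommute: "lie x y = - lie y x"
  by (simp_all add: lie_def)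

lemma norm_lie_commute: "norm (lie x y) = norm (lie y (x :: 'a::real_normed_algebra))"
  by (metis lie_anticommute norm_minus_cancel)

text \<open>The hypothesis bounds \<open>F (f s)\<close> rather than \<open>f s\<close>, because F
  will be a nested commutator with its other entries fixed, and only nested commutators have the
  sharp bounds.\<close>

lemma norm_linear_integral_le:
  fixes f :: "real \<Rightarrow> 'a::banach" and F :: "'a \<Rightarrow> 'b::banach"
  assumes "bounded_linear F" "continuous_on {a..b} f" "a \<le> b"
    and "\<And>s. s \<in> {a..b} \<Longrightarrow> norm (F (f s)) \<le> e"
  shows "norm (F (integral {a..b} f)) \<le> (b - a) * e"
proof -
  have "F (integral {a..b} f) = integral {a..b} (F \<circ> f)"
    using assms(1,2) by (simp add: integral_linear integrable_continuous_real)
  also have "norm \<dots> \<le> e * (b - a)"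
    using assms
    by (intro integral_bound)
      (auto intro!: bounded_linear.continuous_on[OF assms(1)] simp: o_def)
  finally show ?thesis
    by (simp add: mult.commute)
qed

text \<open>A bound that grows linearly from 0 gains a factor 1/2 on integration. This serves
  integrands that contain an integral from a to s themselves.\<close>

lemma norm_linear_integral_le_linear:
  fixes f :: "real \<Rightarrow> 'a::banach" and F :: "'a \<Rightarrow> 'b::banach"
  assumes "bounded_linear F" "continuous_on {a..b} f" "a \<le> b"
    and "\<And>s. s \<in> {a..b} \<Longrightarrow> norm (F (f s)) \<le> (s - a) * e"
  shows "norm (F (integral {a..b} f)) \<le> (b - a)\<^sup>2 / 2 * e"
proof -
  have hi: "((\<lambda>s. (s - a) * e) has_integral ((b - a)\<^sup>2 / 2 * e - (a - a)\<^sup>2 / 2 * e)) {a..b}"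
    using assms(3)
    by (intro fundamental_theorem_of_calculus)
      (auto intro!: derivative_eq_intros simp flip: has_real_derivative_iff_has_vector_derivative)
  have "F (integral {a..b} f) = integral {a..b} (F \<circ> f)"
    using assms(1,2) by (simp add: integral_linear integrable_continuous_real)
  also have "norm \<dots> \<le> integral {a..b} (\<lambda>s. (s - a) * e)"
    using assms hi
    by (intro integral_norm_bound_integral)
      (auto intro!: integrable_continuous_real bounded_linear.continuous_on[OF assms(1)]
         continuous_intros simp: o_def)
  also have "\<dots> = (b - a)\<^sup>2 / 2 * e"
    using integral_unique[OF hi] by simp
  finally show ?thesis .
qed

lemma norm_integral_le:
  fixes f :: "real \<Rightarrow> 'a::banach"
  assumes "continuous_on {a..b} f" "a \<le> b" "\<And>s. s \<in> {a..b} \<Longrightarrow> norm (f s) \<le> e"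
  shows "norm (integral {a..b} f) \<le> (b - a) * e"
  using norm_linear_integral_le[OF bounded_linear_ident assms] .

lemma norm_has_integral_le:
  fixes f :: "real \<Rightarrow> 'a::banach"
  assumes "(f has_integral i) {a..b}" "(g has_integral j) {a..b}"
    and "\<And>u. u \<in> {a..b} \<Longrightarrow> norm (f u) \<le> g u"
  shows "norm i \<le> j"
  using integral_norm_bound_integral[of f "{a..b}" g] assms
  by (metis has_integral_integrable_integral)

lemma norm_has_integral_unit_le:
  fixes f :: "real \<Rightarrow> 'a::real_normed_vector"
  assumes "(f has_integral i) {0..1}" "\<And>u. u \<in> {0..1} \<Longrightarrow> norm (f u) \<le> e"
  shows "norm i \<le> e"
proof -
  have "0 \<le> e"
    using order_trans[OF norm_ge_zero assms(2)[of 0]] by simp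
  from has_integral_bound_real[OF this finite.emptyI assms(1)] assms(2) show ?thesis by simp
qed

section \<open>Exponentials along a segment and Duhamel's formula\<close>

lemma continuous_on_exp_scaleR [continuous_intros]:
  fixes x :: "'a::{real_normed_algebra_1,banach}"
  assumes "continuous_on S f"
  shows "continuous_on S (\<lambda>u. exp (f u *\<^sub>R x))"
proof -
  have "continuous_on UNIV (\<lambda>u. exp (u *\<^sub>R x))"
    by (rule continuous_on_vector_derivative[OF exp_scaleR_has_vector_derivative_right])
  from continuous_on_compose2[OF this assms] show ?thesis by simp
qed

lemma exp_one_minus_scaleR_has_vector_derivative:
  fixes x :: "'a::{real_normed_algebra_1,banach}"
  shows "((\<lambda>u. exp ((1 - u) *\<^sub>R x)) has_vector_derivative - (exp ((1 - u) *\<^sub>R x) * x)) (at u within S)"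
proof -
  have "((\<lambda>u::real. 1 - u) has_vector_derivative - 1) (at u within S)"
    by (auto intro!: derivative_eq_intros)
  from vector_diff_chain_within[OF this exp_scaleR_has_vector_derivative_right]
  show ?thesis by (simp add: o_def)
qed

text \<open>Duhamel's formula: \<open>exp ((1 - u) *\<^sub>R x) * exp (u *\<^sub>R y)\<close> runs
  from \<open>exp x\<close> at 0 to \<open>exp y\<close> at 1, and its derivative in u is minus the
  integrand.\<close>

lemma has_integral_exp_diff:
  fixes x y :: "'a::{real_normed_algebra_1,banach}"
  shows "((\<lambda>u. exp ((1 - u) *\<^sub>R x) * (x - y) * exp (u *\<^sub>R y)) has_integral exp x - exp y) {0..1}"
proof -
  let ?q = "\<lambda>u. exp ((1 - u) *\<^sub>R x) * exp (u *\<^sub>R y)"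
  have e: "((\<lambda>u. exp (u *\<^sub>R y)) has_vector_derivative y * exp (u *\<^sub>R y)) (at u within S)" for u S
    by (rule has_vector_derivative_at_within[OF exp_scaleR_has_vector_derivative_left])
  have "((\<lambda>u. - (exp ((1 - u) *\<^sub>R x) * (x - y) * exp (u *\<^sub>R y))) has_integral ?q 1 - ?q 0) {0..1}"
    by (intro fundamental_theorem_of_calculus)
      (simp, rule has_vector_derivative_eq_rhs[OF has_vector_derivative_mult[OF exp_one_minus_scaleR_has_vector_derivative e]],
        simp add: algebra_simps)
  from has_integral_neg[OF this] show ?thesis by simp
qed

section \<open>Exponentials of skew-adjoint elements\<close>

text \<open>A unital C*-algebra regarded over the reals: with -i absorbed into A, the scalars in the
  analysis are real. The last axiom is the C*-identity, which makes the adjoint isometric and gives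
  unitaries norm 1.\<close>

locale star_algebra =
  fixes star :: "'a::{real_normed_algebra_1,banach} \<Rightarrow> 'a"
  assumes star_add: "star (x + y) = star x + star y"
    and star_scaleR: "star (r *\<^sub>R x) = r *\<^sub>R star x"
    and star_mult: "star (x * y) = star y * star x"
    and star_star [simp]: "star (star x) = x"
    and norm_star_mult: "norm (star x * x) = (norm x)\<^sup>2"
begin

definition skew :: "'a \<Rightarrow> bool" where
  "skew x \<longleftrightarrow> star x = - x"

text \<open>Cancel \<open>norm x\<close> in the C*-identity. Applied to \<open>star x\<close> as
  well, this shows that \<open>star\<close> is isometric, hence continuous.\<close>

lemma norm_le_star: "norm x \<le> norm (star x)"
proof (cases "x = 0")
  case False
  have "norm x * norm x \<le> norm (star x) * norm x"
    using norm_mult_ineq[of "star x" x] by (simp add: norm_star_mult power2_eq_square)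
  then show ?thesis using False by simp
qed simp

lemma bounded_linear_star: "bounded_linear star"
proof (rule bounded_linear_intro[where K = 1])
  show "norm (star x) \<le> norm x * 1" for x
    using norm_le_star[of "star x"] by simp
qed (simp_all add: star_add star_scaleR)

interpretation star: bounded_linear star
  by (rule bounded_linear_star)

lemma star_1 [simp]: "star 1 = 1"
  by (metis mult_1 mult_1_right star_mult star_star)

lemma star_power: "star (x ^ n) = star x ^ n"
  by (induction n) (simp_all add: star_mult power_commutes)

lemma star_exp: "star (exp x) = exp (star x)"
proof -
  have "(\<lambda>n. star (x ^ n /\<^sub>R fact n)) sums star (exp x)"
    by (rule star.sums[OF exp_converges])
  then have "(\<lambda>n. star x ^ n /\<^sub>R fact n) sums star (exp x)"
    by (simp add: star_power star_scaleR)
  then show ?thesis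
    using exp_converges[of "star x"] sums_unique2 by blast
qed

lemma norm_unitary: "star x * x = 1 \<Longrightarrow> norm x = 1"
  using norm_star_mult[of x] by (simp add: power2_eq_1_iff) (metis norm_ge_zero not_one_le_zero
    le_minus_one_simps(3))

text \<open>The adjoint of \<open>exp x\<close> is \<open>exp (- x)\<close>, its inverse, so
  \<open>exp x\<close> is unitary.\<close>

lemma norm_exp_skew: "skew x \<Longrightarrow> norm (exp x) = 1"
  by (rule norm_unitary) (simp add: star_exp skew_def flip: exp_minus_inverse[of "- x", simplified])

lemma norm_exp_mult_le:
  assumes "skew x" "skew y"
  shows "norm (exp x * z * exp y) \<le> norm z"
proof -
  have "norm (exp x * z * exp y) \<le> norm (exp x * z) * norm (exp y)"
    by (rule norm_mult_ineq)
  also have "\<dots> \<le> norm (exp x) * norm z * norm (exp y)"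
    by (intro mult_right_mono norm_mult_ineq) simp
  finally show ?thesis using assms by (simp add: norm_exp_skew)
qed

lemma skew_scaleR: "skew x \<Longrightarrow> skew (r *\<^sub>R x)"
  by (simp add: skew_def star_scaleR)

lemma skew_0: "skew 0"
  by (simp add: skew_def star.zero)

lemma skew_minus: "skew x \<Longrightarrow> skew (- x)"
  by (simp add: skew_def star.neg)

lemma skew_diff: "skew x \<Longrightarrow> skew y \<Longrightarrow> skew (x - y)"
  by (simp add: skew_def star.diff)

lemma skew_sum: "(\<And>i. i \<in> I \<Longrightarrow> skew (f i)) \<Longrightarrow> skew (sum f I)"
  by (simp add: skew_def star.sum sum_negf)

lemma skew_lie: "skew x \<Longrightarrow> skew y \<Longrightarrow> skew (lie x y)"
  by (simp add: skew_def lie_def star.diff star_mult)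

lemma skew_integral:
  fixes f :: "real \<Rightarrow> 'a"
  assumes "continuous_on {a..b} f" "\<And>s. s \<in> {a..b} \<Longrightarrow> skew (f s)"
  shows "skew (integral {a..b} f)"
proof -
  have "star (integral {a..b} f) = integral {a..b} (star \<circ> f)"
    using assms(1)
    by (intro integral_linear[symmetric] bounded_linear_star integrable_continuous_real)
  also have "\<dots> = integral {a..b} (\<lambda>s. - f s)"
    using assms(2) by (intro integral_cong) (simp add: skew_def)
  finally show ?thesis by (simp add: skew_def)
qed

text \<open>In Duhamel's formula the difference \<open>x - y\<close> stands between two unitary
  factors, which do not increase its norm.\<close>

lemma norm_exp_diff_le:
  assumes "skew x" "skew y"
  shows "norm (exp x - exp y) \<le> norm (x - y)"
proof -
  show ?thesis
    by (rule norm_has_integral_unit_le[OF has_integral_exp_diff])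
      (intro norm_exp_mult_le skew_scaleR assms)
qed

text \<open>The values of P at different times need not commute, so the derivative is a Duhamel
  integral. Applied to \<open>P s\<close> and \<open>P t\<close>, Duhamel's formula gives the
  increment exactly; moving the left exponential from \<open>P s\<close> to \<open>P t\<close> costs
  only second order by the Lipschitz bound.\<close>

lemma exp_has_vector_derivative_skew:
  assumes skew: "\<And>s. s \<in> S \<Longrightarrow> skew (P s)" and t: "t \<in> S"
    and P: "(P has_vector_derivative P') (at t within S)"
  shows "((\<lambda>s. exp (P s)) has_vector_derivative
      integral {0..1} (\<lambda>u. exp ((1 - u) *\<^sub>R P t) * P' * exp (u *\<^sub>R P t))) (at t within S)"
    (is "(_ has_vector_derivative integral _ ?k) _")
  unfolding has_vector_derivative_def
\<comment> \<open>The estimate below holds at every distance, so the radius 1 is arbitrary.\<close>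
proof (rule has_derivativeI_sandwich[where e = 1])
  \<comment> \<open>\<open>?r\<close> tends to 0 by differentiability of P. In \<open>?H\<close> the
    first summand dominates the quadratic error divided by \<open>norm (s - t)\<close>: a bounded
    factor times one that vanishes by continuity.\<close>
  let ?r = "\<lambda>s. norm (P s - P t - (s - t) *\<^sub>R P') / norm (s - t)"
  let ?H = "\<lambda>s. (?r s + norm P') * norm (P s - P t) + ?r s"
  fix s assume s: "s \<in> S" "s \<noteq> t" "dist s t < 1"
  have k: "(?k has_integral integral {0..1} ?k) {0..1}"
    by (intro integrable_integral integrable_continuous_real continuous_intros)
  have "((\<lambda>u. exp ((1 - u) *\<^sub>R P s) * (P s - P t) * exp (u *\<^sub>R P t) - (s - t) *\<^sub>R ?k u) has_integral
      exp (P s) - exp (P t) - (s - t) *\<^sub>R integral {0..1} ?k) {0..1}"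
    by (intro has_integral_diff has_integral_exp_diff has_integral_cmul k)
  moreover have "norm (exp ((1 - u) *\<^sub>R P s) * (P s - P t) * exp (u *\<^sub>R P t) - (s - t) *\<^sub>R ?k u)
      \<le> norm (P s - P t) * norm (P s - P t) + norm (P s - P t - (s - t) *\<^sub>R P')"
    if u: "u \<in> {0..1}" for u
  proof -
    have sk: "skew (P s)" "skew (P t)" using skew s t by auto
    let ?E = "\<lambda>s. exp ((1 - u) *\<^sub>R P s)" and ?F = "exp (u *\<^sub>R P t)"
    have F: "norm ?F = 1" by (intro norm_exp_skew skew_scaleR sk)
    \<comment> \<open>The first summand is the cost of replacing \<open>?E s\<close> by
      \<open>?E t\<close>, the second that of linearizing P at t.\<close>
    have "?E s * (P s - P t) * ?F - (s - t) *\<^sub>R ?k u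
        = (?E s - ?E t) * (P s - P t) * ?F + ?E t * (P s - P t - (s - t) *\<^sub>R P') * ?F"
      by (simp add: algebra_simps)
    also have "norm \<dots> \<le> norm ((?E s - ?E t) * (P s - P t) * ?F)
        + norm (?E t * (P s - P t - (s - t) *\<^sub>R P') * ?F)"
      by (rule norm_triangle_ineq)
    also have "norm ((?E s - ?E t) * (P s - P t) * ?F) \<le> norm (?E s - ?E t) * norm (P s - P t)"
      using norm_mult_ineq[of "(?E s - ?E t) * (P s - P t)" ?F]
        norm_mult_ineq[of "?E s - ?E t" "P s - P t"] by (simp add: F)
    also have "norm (?E s - ?E t) \<le> norm ((1 - u) *\<^sub>R P s - (1 - u) *\<^sub>R P t)"
      by (intro norm_exp_diff_le skew_scaleR sk)
    also have "\<dots> = \<bar>1 - u\<bar> * norm (P s - P t)"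
      by (simp flip: scaleR_diff_right)
    also have "\<dots> \<le> norm (P s - P t)"
      using u by (intro mult_left_le_one_le) auto
    also have "norm (?E t * (P s - P t - (s - t) *\<^sub>R P') * ?F) \<le> norm (P s - P t - (s - t) *\<^sub>R P')"
      by (intro norm_exp_mult_le skew_scaleR sk)
    finally show ?thesis
      by (simp add: mult_right_mono)
  qed
  ultimately have "norm (exp (P s) - exp (P t) - (s - t) *\<^sub>R integral {0..1} ?k)
      \<le> (norm (P s - P t) * norm (P s - P t) + norm (P s - P t - (s - t) *\<^sub>R P'))"
    by (rule norm_has_integral_unit_le)
  moreover have "norm (P s - P t) \<le> norm (P s - P t - (s - t) *\<^sub>R P') + norm P' * norm (s - t)"
    using norm_triangle_ineq[of "P s - P t - (s - t) *\<^sub>R P'" "(s - t) *\<^sub>R P'"]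
    by (simp add: mult.commute)
  from divide_right_mono[OF this, of "norm (s - t)"]
  have "norm (P s - P t) / norm (s - t) \<le> ?r s + norm P'"
    using s by (simp add: add_divide_distrib)
  from mult_right_mono[OF this, of "norm (P s - P t)"]
  have "norm (P s - P t) * norm (P s - P t) / norm (s - t) \<le> (?r s + norm P') * norm (P s - P t)"
    by simp
  ultimately show "norm (exp (P s) - exp (P t) - (s - t) *\<^sub>R integral {0..1} ?k) / norm (s - t) \<le> ?H s"
    using divide_right_mono[of _ _ "norm (s - t)"] by (fastforce simp: add_divide_distrib)
next
  have P0: "((\<lambda>s. norm (P s - P t - (s - t) *\<^sub>R P') / norm (s - t)) \<longlongrightarrow> 0) (at t within S)"
    using P by (simp add: has_vector_derivative_def has_derivative_iff_norm)
  have "((\<lambda>s. P s - P t) \<longlongrightarrow> P t - P t) (at t within S)"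
    using has_vector_derivative_continuous[OF P]
    by (intro tendsto_intros) (simp add: continuous_within)
  then have c: "((\<lambda>s. norm (P s - P t)) \<longlongrightarrow> 0) (at t within S)"
    by (simp add: tendsto_norm_zero)
  show "((\<lambda>s. (norm (P s - P t - (s - t) *\<^sub>R P') / norm (s - t) + norm P') * norm (P s - P t)
       + norm (P s - P t - (s - t) *\<^sub>R P') / norm (s - t)) \<longlongrightarrow> 0) (at t within S)"
    using tendsto_add[OF tendsto_mult[OF tendsto_add[OF P0 tendsto_const] c] P0] by simp
qed (auto intro: bounded_linear_scaleR_left)

end

section \<open>The Magnus expansion on one time step\<close>

text \<open>The second-order exponent in terms of A = -iH: the product of two factors -i is -1, so
  the sign of the commutator term is opposite to that in \<open>magnus2\<close>.\<close>

definition magnus :: "(real \<Rightarrow> 'a::{real_normed_algebra,banach}) \<Rightarrow> real \<Rightarrow> real \<Rightarrow> 'a" where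
  "magnus A a b = integral {a..b} A - (1 / 2) *\<^sub>R integral {a..b} (\<lambda>s. lie (integral {a..s} A) (A s))"

context star_algebra
begin

text \<open>Conjugation along the segment turns differentiation into a commutator with X. The mean
  over u is expanded about u = 0, with K as a proxy for \<open>lie X Y\<close>: the part K is
  followed one order further, the rest is only bounded. With X and Y the Magnus exponent and its
  derivative, \<open>Y + (1 / 2) *\<^sub>R K\<close> will be A.\<close>

lemma dexp_approx:
  assumes X: "skew X"
  shows "norm (integral {0..1} (\<lambda>u. exp ((1 - u) *\<^sub>R (- X)) * Y * exp (u *\<^sub>R (- X)))
      - exp (- X) * (Y + (1 / 2) *\<^sub>R K)) \<le> norm (lie X K) / 6 + norm (lie X Y - K) / 2"
proof -
  define \<psi> where "\<psi> Z u = exp ((1 - u) *\<^sub>R (- X)) * Z * exp (u *\<^sub>R (- X))" for Z and u :: real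
  let ?N = "norm (lie X K)" and ?M = "norm (lie X Y - K)"
  have d: "(\<psi> Z has_vector_derivative \<psi> (lie X Z) u) (at u within S)" for Z u S
  proof -
    have "((\<lambda>u. exp ((1 - u) *\<^sub>R (- X)) * Z) has_vector_derivative
        - (exp ((1 - u) *\<^sub>R (- X)) * (- X)) * Z) (at u within S)"
      by (intro has_vector_derivative_mult_left exp_one_minus_scaleR_has_vector_derivative)
    from has_vector_derivative_mult[OF this
        has_vector_derivative_at_within[OF exp_scaleR_has_vector_derivative_left[of "- X"]]]
    show ?thesis
      unfolding \<psi>_def
      by (rule has_vector_derivative_eq_rhs) (simp add: lie_def algebra_simps)
  qed
  have \<psi>_diff: "\<psi> (Z - W) u = \<psi> Z u - \<psi> W u" for Z W u
    by (simp add: \<psi>_def algebra_simps)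
  have \<psi>_le: "norm (\<psi> Z u) \<le> norm Z" for Z u
    unfolding \<psi>_def using X by (intro norm_exp_mult_le skew_scaleR skew_minus)
  have \<psi>_0: "\<psi> Z 0 = exp (- X) * Z" for Z
    by (simp add: \<psi>_def)
  have ftc: "(\<psi> (lie X Z) has_integral \<psi> Z u - \<psi> Z 0) {0..u}" if "u \<ge> 0" for Z u
    using that by (intro fundamental_theorem_of_calculus d)
  \<comment> \<open>Three successive integrations follow: a bound for K linear in u, a bound for Y
    that is quadratic in u, and finally the mean over the unit interval, where u^2/2 becomes 1/6 and
    u becomes 1/2.\<close>
  have K: "norm (\<psi> K u - \<psi> K 0) \<le> u * ?N" if "u \<ge> 0" for u
    using has_integral_bound_real[OF _ finite.emptyI ftc[OF that], of ?N K] that \<psi>_le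
    by (simp add: mult.commute)
  have Y: "norm (\<psi> Y u - \<psi> Y 0 - u *\<^sub>R \<psi> K 0) \<le> u\<^sup>2 / 2 * ?N + u * ?M" if u: "u \<ge> 0" for u
  proof (rule norm_has_integral_le)
    show "((\<lambda>v. \<psi> (lie X Y) v - \<psi> K 0) has_integral \<psi> Y u - \<psi> Y 0 - u *\<^sub>R \<psi> K 0) {0..u}"
      using has_integral_diff[OF ftc[OF u] has_integral_const_real[of "\<psi> K 0" 0 u]] u by simp
    have "((\<lambda>v. v * ?N + ?M) has_integral (u\<^sup>2 / 2 * ?N + u * ?M) - (0\<^sup>2 / 2 * ?N + 0 * ?M)) {0..u}"
      using u by (intro fundamental_theorem_of_calculus)
       (auto intro!: derivative_eq_intros simp flip: has_real_derivative_iff_has_vector_derivative)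
    then show "((\<lambda>v. v * ?N + ?M) has_integral (u\<^sup>2 / 2 * ?N + u * ?M)) {0..u}"
      by simp
    show "norm (\<psi> (lie X Y) v - \<psi> K 0) \<le> v * ?N + ?M" if v: "v \<in> {0..u}" for v
    proof -
      have "\<psi> (lie X Y) v - \<psi> K 0 = (\<psi> K v - \<psi> K 0) + \<psi> (lie X Y - K) v"
        by (simp add: \<psi>_diff)
      also have "norm \<dots> \<le> v * ?N + ?M"
        using v by (intro norm_triangle_mono K \<psi>_le) auto
      finally show ?thesis .
    qed
  qed
  have "norm (integral {0..1} (\<psi> Y) - \<psi> Y 0 - (1 / 2) *\<^sub>R \<psi> K 0) \<le> ?N / 6 + ?M / 2"
  proof (rule norm_has_integral_le)
    have "continuous_on {0..1} (\<psi> Y)"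
      by (rule continuous_on_vector_derivative[OF d])
    then have "(\<psi> Y has_integral integral {0..1} (\<psi> Y)) {0..1}"
      by (intro integrable_integral integrable_continuous_real)
    moreover have "((\<lambda>u. u *\<^sub>R \<psi> K 0) has_integral (1\<^sup>2 / 2) *\<^sub>R \<psi> K 0 - (0\<^sup>2 / 2) *\<^sub>R \<psi> K 0) {0..1}"
      by (intro fundamental_theorem_of_calculus)
        (auto intro!: derivative_eq_intros)
    ultimately show "((\<lambda>u. \<psi> Y u - \<psi> Y 0 - u *\<^sub>R \<psi> K 0) has_integral
        integral {0..1} (\<psi> Y) - \<psi> Y 0 - (1 / 2) *\<^sub>R \<psi> K 0) {0..1}"
      using has_integral_const_real[of "\<psi> Y 0" 0 1] by (auto intro!: has_integral_diff)
    have "((\<lambda>u. u\<^sup>2 / 2 * ?N + u * ?M) has_integral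
        (1 ^ 3 / 6 * ?N + 1\<^sup>2 / 2 * ?M) - (0 ^ 3 / 6 * ?N + 0\<^sup>2 / 2 * ?M)) {0..1}"
      by (intro fundamental_theorem_of_calculus)
       (auto intro!: derivative_eq_intros simp flip: has_real_derivative_iff_has_vector_derivative)
    then show "((\<lambda>u. u\<^sup>2 / 2 * ?N + u * ?M) has_integral ?N / 6 + ?M / 2) {0..1}"
      by simp
  qed (use Y in auto)
  then show ?thesis
    unfolding \<psi>_0 by (simp add: \<psi>_def[abs_def] algebra_simps)
qed

section \<open>Local error of one Magnus step\<close>

lemma skew_magnus:
  assumes contA: "continuous_on {a..b} A" and skewA: "\<And>t. t \<in> {a..b} \<Longrightarrow> skew (A t)"
  shows "skew (magnus A a b)"
proof -
  have B: "continuous_on {a..b} (\<lambda>t. integral {a..t} A)"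
    by (intro indefinite_integral_continuous_1 integrable_continuous_real contA)
  have "skew (integral {a..t} A)" if "t \<in> {a..b}" for t
    using that by (intro skew_integral continuous_on_subset[OF contA] skewA) auto
  then show ?thesis
    unfolding magnus_def
    by (intro skew_diff skew_scaleR skew_integral[OF contA] skew_lie skewA
        skew_integral[OF lie.continuous_on[OF B contA]])
qed

text \<open>The commutator bounds are pointwise in A; multilinearity pulls the integrals in B, C and
  K out of the commutators. U may start from any value at a, so the global propagator can be
  inserted on every step.\<close>

lemma magnus_step:
  fixes A :: "real \<Rightarrow> 'a"
  assumes ab: "a \<le> b" and contA: "continuous_on {a..b} A"
    and skewA: "\<And>t. t \<in> {a..b} \<Longrightarrow> skew (A t)"
    and triple: "\<And>r s t. r \<in> {a..b} \<Longrightarrow> s \<in> {a..b} \<Longrightarrow> t \<in> {a..b} \<Longrightarrow>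
      norm (lie (lie (A r) (A s)) (A t)) \<le> \<alpha>"
    and quadruple: "\<And>q r s t. q \<in> {a..b} \<Longrightarrow> r \<in> {a..b} \<Longrightarrow> s \<in> {a..b} \<Longrightarrow> t \<in> {a..b} \<Longrightarrow>
      norm (lie (lie (A q) (A r)) (lie (A s) (A t))) \<le> \<beta>"
    and U: "\<And>t. t \<in> {a..b} \<Longrightarrow> (U has_vector_derivative A t * U t) (at t within {a..b})"
    and normU: "\<And>t. t \<in> {a..b} \<Longrightarrow> norm (U t) \<le> 1"
  shows "norm (U b - exp (magnus A a b) * U a) \<le> 13 / 24 * (b - a) ^ 3 * \<alpha> + 5 / 48 * (b - a) ^ 4 * \<beta>"
proof -
  define B where "B t = integral {a..t} A" for t
  define K where "K t = lie (B t) (A t)" for t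
  define C where "C t = - (1 / 2) *\<^sub>R integral {a..t} K" for t
  define \<Omega> where "\<Omega> t = B t + C t" for t
  have \<Omega>_magnus: "\<Omega> t = magnus A a t" for t
    by (simp add: \<Omega>_def C_def magnus_def K_def[abs_def] B_def)
  have nonneg: "0 \<le> \<alpha>" "0 \<le> \<beta>"
    using order_trans[OF norm_ge_zero triple[of a a a]]
      order_trans[OF norm_ge_zero quadruple[of a a a a]] ab by auto
  have dB: "(B has_vector_derivative A t) (at t within {a..b})" if "t \<in> {a..b}" for t
    unfolding B_def[abs_def] using integral_has_vector_derivative[OF contA that] .
  have contB: "continuous_on {a..b} B"
    by (rule continuous_on_vector_derivative[OF dB])
  have contK: "continuous_on {a..b} K"
    unfolding K_def[abs_def] by (intro lie.continuous_on contB contA)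
  have dC: "(C has_vector_derivative - (1 / 2) *\<^sub>R K t) (at t within {a..b})" if "t \<in> {a..b}" for t
    unfolding C_def[abs_def]
    by (rule bounded_linear.has_vector_derivative[OF bounded_linear_scaleR_right
          integral_has_vector_derivative[OF contK that]])
  have d\<Omega>: "(\<Omega> has_vector_derivative A t - (1 / 2) *\<^sub>R K t) (at t within {a..b})" if "t \<in> {a..b}" for t
    unfolding \<Omega>_def[abs_def] using has_vector_derivative_add[OF dB dC] that by simp
  have sub: "continuous_on {a..t} A" "continuous_on {a..t} K" if "t \<in> {a..b}" for t
    using that by (auto intro: continuous_on_subset[OF contA] continuous_on_subset[OF contK])
  have skew\<Omega>: "skew (\<Omega> t)" if "t \<in> {a..b}" for t
    unfolding \<Omega>_magnus using that by (intro skew_magnus sub skewA) auto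
  \<comment> \<open>The linear maps x to [x, y], [y, x], [[x, y], z] and [y, [x, z]], in this order:
    the positions from which an integral is pulled out.\<close>
  note bl = lie.bounded_linear_left lie.bounded_linear_right
    bounded_linear_compose[OF lie.bounded_linear_left lie.bounded_linear_left]
    bounded_linear_compose[OF lie.bounded_linear_right lie.bounded_linear_left]
  \<comment> \<open>One factor 1/2 comes from the definition of C, the other from integrating s - a,
    the length of the integral inside \<open>K s\<close>.\<close>
  have CA: "norm (lie (C t) (A t)) \<le> (t - a)\<^sup>2 / 4 * \<alpha>" if t: "t \<in> {a..b}" for t
  proof -
    have "norm (lie (K s) (A t)) \<le> (s - a) * \<alpha>" if s: "s \<in> {a..t}" for s
      unfolding K_def B_def
      by (rule norm_linear_integral_le[OF bl(3)]) (use s t in \<open>auto intro!: sub triple\<close>)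
    then have "norm (lie (integral {a..t} K) (A t)) \<le> (t - a)\<^sup>2 / 2 * \<alpha>"
      using t by (intro norm_linear_integral_le_linear[OF bl(1)] sub) auto
    then show ?thesis
      by (simp add: C_def lie.scaleR_left lie.minus_left)
  qed
  \<comment> \<open>The integral inside \<open>K t\<close> has length t - a for every s, so there is
    no gain of 1/2 here.\<close>
  have BK: "norm (lie (B t) (K t)) \<le> (t - a)\<^sup>2 * \<alpha>" if t: "t \<in> {a..b}" for t
  proof -
    have "norm (lie (A s) (K t)) \<le> (t - a) * \<alpha>" if s: "s \<in> {a..t}" for s
      unfolding K_def B_def
      by (rule norm_linear_integral_le[OF bl(4)])
        (use s t in \<open>auto intro!: sub triple simp: norm_lie_commute[of "A s"]\<close>)
    then have "norm (lie (integral {a..t} A) (K t)) \<le> (t - a) * ((t - a) * \<alpha>)"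
      using t by (intro norm_linear_integral_le[OF bl(1)] sub) auto
    then show ?thesis
      by (simp add: B_def power2_eq_square mult.assoc)
  qed
  \<comment> \<open>\<open>K t\<close> contributes t - a, and C contributes a quarter of its square
    as before.\<close>
  have CK: "norm (lie (C t) (K t)) \<le> (t - a) ^ 3 / 4 * \<beta>" if t: "t \<in> {a..b}" for t
  proof -
    have "norm (lie (lie (A r) (A s)) (K t)) \<le> (t - a) * \<beta>" if "r \<in> {a..t}" "s \<in> {a..t}" for r s
      unfolding K_def B_def
      by (rule norm_linear_integral_le[OF bl(4)]) (use that t in \<open>auto intro!: sub quadruple\<close>)
    then have "norm (lie (K s) (K t)) \<le> (s - a) * ((t - a) * \<beta>)" if s: "s \<in> {a..t}" for s
      unfolding K_def[of s] B_def
      by (intro norm_linear_integral_le[OF bl(3)]) (use s t in \<open>auto intro!: sub\<close>)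
    then have "norm (lie (integral {a..t} K) (K t)) \<le> (t - a)\<^sup>2 / 2 * ((t - a) * \<beta>)"
      using t by (intro norm_linear_integral_le_linear[OF bl(1)] sub) auto
    then show ?thesis
      by (simp add: C_def lie.scaleR_left lie.minus_left power2_eq_square power3_eq_cube)
  qed
  \<comment> \<open>The Duhamel integral for \<open>exp (- \<Omega>)\<close>, with the sign chosen
    so that \<open>- E t\<close> is the derivative.\<close>
  define E where "E t = integral {0..1} (\<lambda>u. exp ((1 - u) *\<^sub>R (- \<Omega> t)) * (A t - (1 / 2) *\<^sub>R K t)
      * exp (u *\<^sub>R (- \<Omega> t)))" for t
  have E: "norm (E t - exp (- \<Omega> t) * A t) \<le> 13 / 24 * (b - a)\<^sup>2 * \<alpha> + 5 / 48 * (b - a) ^ 3 * \<beta>"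
    if t: "t \<in> {a..b}" for t
  proof -
    have N: "lie (\<Omega> t) (K t) = lie (B t) (K t) + lie (C t) (K t)"
      by (simp add: \<Omega>_def lie.add_left)
    then have "norm (lie (\<Omega> t) (K t)) \<le> (t - a)\<^sup>2 * \<alpha> + (t - a) ^ 3 / 4 * \<beta>"
      using norm_triangle_mono[OF BK[OF t] CK[OF t]] by simp
    \<comment> \<open>The commutator of \<open>B t\<close> with \<open>A t\<close> is
      \<open>K t\<close> itself and cancels.\<close>
    moreover have "lie (\<Omega> t) (A t - (1 / 2) *\<^sub>R K t) - K t = lie (C t) (A t) - (1 / 2) *\<^sub>R lie (\<Omega> t) (K t)"
      by (simp add: \<Omega>_def lie.add_left lie.diff_right lie.scaleR_right K_def)
    then have "norm (lie (\<Omega> t) (A t - (1 / 2) *\<^sub>R K t) - K t)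
        \<le> (t - a)\<^sup>2 / 4 * \<alpha> + norm (lie (\<Omega> t) (K t)) / 2"
      using norm_triangle_ineq4[of "lie (C t) (A t)" "(1 / 2) *\<^sub>R lie (\<Omega> t) (K t)"] CA[OF t] by simp
    \<comment> \<open>The norm of [\<Omega>, K] enters with weight 1/6 + 1/4 = 5/12 and that of
      [C, A] with weight 1/2. Hence 5/12 + 1/8 = 13/24 for \<alpha> and 5/12 * 1/4 = 5/48 for
      \<beta>.\<close>
    ultimately have "norm (E t - exp (- \<Omega> t) * A t)
        \<le> 13 / 24 * ((t - a)\<^sup>2 * \<alpha>) + 5 / 48 * ((t - a) ^ 3 * \<beta>)"
      using dexp_approx[OF skew\<Omega>[OF t], of "A t - (1 / 2) *\<^sub>R K t" "K t"] by (simp add: E_def)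
    \<comment> \<open>The bound is made uniform in t, so the later integration contributes a plain
      factor b - a.\<close>
    also have "\<dots> \<le> 13 / 24 * ((b - a)\<^sup>2 * \<alpha>) + 5 / 48 * ((b - a) ^ 3 * \<beta>)"
      using t nonneg by (intro add_mono mult_left_mono mult_right_mono power_mono) auto
    finally show ?thesis by simp
  qed
  \<comment> \<open>The interaction picture: \<open>?Y\<close> would be constant if
    \<open>exp (\<Omega> t)\<close> were the exact propagator.\<close>
  let ?Y = "\<lambda>t. exp (- \<Omega> t) * U t"
  have dY: "(?Y has_vector_derivative (exp (- \<Omega> t) * A t - E t) * U t) (at t within {a..b})"
    if t: "t \<in> {a..b}" for t
  proof -
    have "((\<lambda>s. - \<Omega> s) has_vector_derivative - (A t - (1 / 2) *\<^sub>R K t)) (at t within {a..b})"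
      by (rule has_vector_derivative_minus[OF d\<Omega>[OF t]])
    from exp_has_vector_derivative_skew[OF skew_minus[OF skew\<Omega>] t this]
    have "((\<lambda>s. exp (- \<Omega> s)) has_vector_derivative - E t) (at t within {a..b})"
      unfolding E_def mult_minus_left mult_minus_right integral_neg .
    from has_vector_derivative_mult[OF this U[OF t]]
    show ?thesis by (rule has_vector_derivative_eq_rhs) (simp add: algebra_simps)
  qed
  have "norm ((exp (- \<Omega> t) * A t - E t) * U t) \<le> 13 / 24 * (b - a)\<^sup>2 * \<alpha> + 5 / 48 * (b - a) ^ 3 * \<beta>"
    if t: "t \<in> {a..b}" for t
  proof -
    have "norm ((exp (- \<Omega> t) * A t - E t) * U t) \<le> norm (exp (- \<Omega> t) * A t - E t) * 1"
      using normU[OF t] by (intro order_trans[OF norm_mult_ineq] mult_left_mono) auto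
    then show ?thesis
      using E[OF t] by (simp add: norm_minus_commute)
  qed
  moreover have "((\<lambda>t. (exp (- \<Omega> t) * A t - E t) * U t) has_integral ?Y b - ?Y a) {a..b}"
    using ab by (intro fundamental_theorem_of_calculus dY)
  ultimately have "norm (?Y b - ?Y a) \<le> (13 / 24 * (b - a)\<^sup>2 * \<alpha> + 5 / 48 * (b - a) ^ 3 * \<beta>) * (b - a)"
    using nonneg ab has_integral_bound_real[OF _ finite.emptyI, of _ _ "?Y b - ?Y a" a b] by force
  also have "\<dots> = 13 / 24 * (b - a) ^ 3 * \<alpha> + 5 / 48 * (b - a) ^ 4 * \<beta>"
    by (simp only: distrib_right) (simp add: power2_eq_square power3_eq_cube power4_eq_xxxx mult_ac)
  finally have "norm (?Y b - ?Y a) \<le> 13 / 24 * (b - a) ^ 3 * \<alpha> + 5 / 48 * (b - a) ^ 4 * \<beta>" .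
  moreover have "\<Omega> a = 0"
    by (simp add: \<Omega>_def B_def C_def)
  then have "exp (\<Omega> b) * (?Y b - ?Y a) = exp (\<Omega> b) * exp (- \<Omega> b) * U b - exp (\<Omega> b) * U a"
    by (simp add: right_diff_distrib mult.assoc)
  \<comment> \<open>The trivial factor \<open>exp 0\<close> brings the product into the two-sided
    form of \<open>norm_exp_mult_le\<close>.\<close>
  then have "U b - exp (magnus A a b) * U a = exp (\<Omega> b) * (?Y b - ?Y a) * exp 0"
    by (simp add: exp_minus_inverse flip: \<Omega>_magnus)
  then have "norm (U b - exp (magnus A a b) * U a) \<le> norm (?Y b - ?Y a)"
    using skew\<Omega>[of b] ab norm_exp_mult_le[OF _ skew_0, of "\<Omega> b" "?Y b - ?Y a"] by simp
  ultimately show ?thesis by simp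
qed

end

section \<open>Quadrature and accumulation of errors\<close>

text \<open>The value \<open>g l\<close> attached to a cell is arbitrary, so that it can also be a
  commutator of Riemann sums, which is no sample of f. The number of cells is free, so that inner
  integrals up to a cell boundary are covered.\<close>

lemma integral_cells_approx:
  fixes f :: "real \<Rightarrow> 'a::banach"
  assumes "\<delta> \<ge> 0" "continuous_on {a..a + real k * \<delta>} f"
    and "\<And>l s. l < k \<Longrightarrow> s \<in> {a + real l * \<delta>..a + real (Suc l) * \<delta>} \<Longrightarrow> norm (f s - g l) \<le> e"
  shows "norm (integral {a..a + real k * \<delta>} f - (\<Sum>l<k. \<delta> *\<^sub>R g l)) \<le> real k * \<delta> * e"
  using assms(2,3)
proof (induction k)
  case (Suc k)
  let ?p = "a + real k * \<delta>" and ?q = "a + real (Suc k) * \<delta>"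
  have pq: "a \<le> ?p" "?p \<le> ?q"
    using \<open>\<delta> \<ge> 0\<close> by (auto intro: mult_right_mono)
  have "integral {a..?q} f = integral {a..?p} f + integral {?p..?q} f"
    using pq by (intro Henstock_Kurzweil_Integration.integral_combine[symmetric] integrable_continuous_real
        Suc.prems)
  moreover have "integral {?p..?q} (\<lambda>s. f s - g k) = integral {?p..?q} f - \<delta> *\<^sub>R g k"
    using pq continuous_on_subset[OF Suc.prems(1), of "{?p..?q}"]
    by (subst integral_diff) (auto intro!: integrable_continuous_real simp: algebra_simps)
  ultimately have "integral {a..?q} f - (\<Sum>l<Suc k. \<delta> *\<^sub>R g l)
      = (integral {a..?p} f - (\<Sum>l<k. \<delta> *\<^sub>R g l)) + integral {?p..?q} (\<lambda>s. f s - g k)"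
    unfolding sum.lessThan_Suc by (simp only:) simp
  also have "norm \<dots> \<le> real k * \<delta> * e + (?q - ?p) * e"
    using pq
    by (intro norm_triangle_mono Suc.IH norm_integral_le continuous_intros Suc.prems
        continuous_on_subset[OF Suc.prems(1)]) auto
  finally show ?case by (simp add: algebra_simps)
qed simp

text \<open>The quadrature exponent in terms of A = -iH, again with the sign of the commutator term
  reversed; \<delta> is the cell width.\<close>

definition riemann_magnus :: "(real \<Rightarrow> 'a::real_normed_algebra) \<Rightarrow> nat \<Rightarrow> (nat \<Rightarrow> real) \<Rightarrow> real \<Rightarrow> 'a" where
  "riemann_magnus A M x \<delta> = (\<Sum>k<M. \<delta> *\<^sub>R A (x k))
     - (1 / 2) *\<^sub>R (\<Sum>k<M. \<delta> *\<^sub>R lie (\<Sum>l<k. \<delta> *\<^sub>R A (x l)) (A (x k)))"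

text \<open>On a cell A varies by at most S\<delta>. The plain integral then errs by (b -
  a)S\<delta>, and the halved commutator integral by 2(b - a)^2 \<alpha>S\<delta>.\<close>

lemma riemann_magnus_error:
  fixes A :: "real \<Rightarrow> 'a::{real_normed_algebra,banach}"
  assumes ab: "a \<le> b" and M: "M \<ge> 1" and cont: "continuous_on {a..b} A"
    and bound: "\<And>t. t \<in> {a..b} \<Longrightarrow> norm (A t) \<le> \<alpha>"
    and lipschitz: "\<And>s t. s \<in> {a..b} \<Longrightarrow> t \<in> {a..b} \<Longrightarrow> norm (A s - A t) \<le> S * \<bar>s - t\<bar>"
    and S: "0 \<le> S" and x: "sample_points M x b a"
  shows "norm (magnus A a b - riemann_magnus A M x ((b - a) / real M))
    \<le> (b - a)\<^sup>2 / real M * (1 + 2 * (b - a) * \<alpha>) * S"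
proof -
  define \<delta> where "\<delta> = (b - a) / real M"
  define B where "B t = integral {a..t} A" for t
  define Q where "Q k = (\<Sum>l<k. \<delta> *\<^sub>R A (x l))" for k
  have \<delta>: "\<delta> \<ge> 0" and b: "b = a + real M * \<delta>"
    using ab M by (simp_all add: \<delta>_def)
  have \<alpha>: "\<alpha> \<ge> 0"
    using order_trans[OF norm_ge_zero bound[of a]] ab by simp
  have cell: "a + real k * \<delta> \<ge> a" "a + real k * \<delta> \<le> a + real (Suc k) * \<delta>" "a + real (Suc k) * \<delta> \<le> b"
    if "k < M" for k
    using \<delta> that mult_right_mono[of "real (Suc k)" "real M" \<delta>]
    by (auto simp: b intro: mult_right_mono)
  have xk: "x k \<in> {a + real k * \<delta>..a + real (Suc k) * \<delta>}" if "k < M" for k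
    using x that unfolding sample_points_def \<delta>_def by blast
  have near: "norm (A s - A (x k)) \<le> S * \<delta>"
    if "k < M" "s \<in> {a + real k * \<delta>..a + real (Suc k) * \<delta>}" for k s
  proof -
    have "norm (A s - A (x k)) \<le> S * \<bar>s - x k\<bar>"
      using that xk[of k] cell[of k] by (intro lipschitz) auto
    also have "\<bar>s - x k\<bar> \<le> \<delta>"
      using that xk[of k] by (auto simp: algebra_simps)
    finally show ?thesis using S by (simp add: mult_left_mono)
  qed
  have contB: "continuous_on {a..b} B"
    unfolding B_def[abs_def]
    by (intro indefinite_integral_continuous_1 integrable_continuous_real cont)
  have BQ: "norm (B (a + real k * \<delta>) - Q k) \<le> real k * \<delta> * (S * \<delta>)" if "k \<le> M" for k
    unfolding B_def Q_def
  proof (rule integral_cells_approx)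
    show "continuous_on {a..a + real k * \<delta>} A"
      using that \<delta> by (intro continuous_on_subset[OF cont]) (auto simp: b mult_right_mono intro: order_trans)
  qed (use \<delta> that near in auto)
  have lieBA: "norm (lie (B s) (A s) - lie (Q k) (A (x k))) \<le> 4 * (b - a) * \<alpha> * (S * \<delta>)"
    if k: "k < M" and s: "s \<in> {a + real k * \<delta>..a + real (Suc k) * \<delta>}" for k s
  proof -
    let ?p = "a + real k * \<delta>"
    \<comment> \<open>The part of the current cell up to s is missing from \<open>Q k\<close>. It is
      modelled by a multiple of \<open>A (x k)\<close>, which drops out of the commutator with
      \<open>A (x k)\<close>; otherwise an error of order \<delta> without the factor S would
      remain.\<close>
    let ?D = "B s - Q k - (s - ?p) *\<^sub>R A (x k)"
    have sab: "s \<in> {a..b}" "x k \<in> {a..b}"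
      using s cell[OF k] xk[OF k] by auto
    have sub: "continuous_on {c..s} A" if "c \<ge> a" for c
      using sab that by (intro continuous_on_subset[OF cont]) auto
    have "norm (B s) \<le> (s - a) * \<alpha>"
      unfolding B_def using sab by (intro norm_integral_le bound sub) auto
    also have "\<dots> \<le> (b - a) * \<alpha>"
      using sab \<alpha> by (intro mult_right_mono) auto
    finally have B: "norm (B s) \<le> (b - a) * \<alpha>" .
    have "B s = B ?p + integral {?p..s} A"
      unfolding B_def using s cell[OF k] sub[of a]
      by (intro Henstock_Kurzweil_Integration.integral_combine[symmetric] integrable_continuous_real) auto
    moreover have "integral {?p..s} (\<lambda>u. A u - A (x k)) = integral {?p..s} A - (s - ?p) *\<^sub>R A (x k)"
      using s cell[OF k] sub[of ?p]
      by (subst integral_diff) (auto intro!: integrable_continuous_real)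
    ultimately have "?D = (B ?p - Q k) + integral {?p..s} (\<lambda>u. A u - A (x k))"
      by simp
    also have "norm \<dots> \<le> real k * \<delta> * (S * \<delta>) + (s - ?p) * (S * \<delta>)"
      using s k cell[OF k]
      by (intro norm_triangle_mono BQ norm_integral_le near continuous_intros sub) auto
    \<comment> \<open>The k full cells and the partial one together have length s - a.\<close>
    also have "\<dots> = (s - a) * (S * \<delta>)"
      by (simp add: algebra_simps)
    also have "\<dots> \<le> (b - a) * (S * \<delta>)"
      using sab S \<delta> by (intro mult_right_mono) auto
    finally have D: "norm ?D \<le> (b - a) * (S * \<delta>)" .
    have "lie (B s) (A s) - lie (Q k) (A (x k)) = lie (B s) (A s - A (x k)) + lie ?D (A (x k))"
      by (simp add: lie.diff_left lie.diff_right lie.scaleR_left)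
    also have "norm \<dots> \<le> 2 * norm (B s) * norm (A s - A (x k)) + 2 * norm ?D * norm (A (x k))"
      by (intro norm_triangle_mono norm_lie_le)
    \<comment> \<open>Both commutators are bounded by twice the product of norms, whence the
      constant 4.\<close>
    also have "\<dots> \<le> 2 * ((b - a) * \<alpha>) * (S * \<delta>) + 2 * ((b - a) * (S * \<delta>)) * \<alpha>"
      using B D near[OF k s] bound[OF sab(2)] \<alpha> ab S \<delta> by (intro add_mono mult_mono) auto
    finally show ?thesis by (simp add: algebra_simps)
  qed
  have "norm (integral {a..b} A - Q M) \<le> real M * \<delta> * (S * \<delta>)"
    using BQ[of M] by (simp add: B_def b)
  moreover have "norm (integral {a..b} (\<lambda>s. lie (B s) (A s)) - (\<Sum>k<M. \<delta> *\<^sub>R lie (Q k) (A (x k))))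
      \<le> real M * \<delta> * (4 * (b - a) * \<alpha> * (S * \<delta>))"
    using integral_cells_approx[OF \<delta>, of a M "\<lambda>s. lie (B s) (A s)" "\<lambda>k. lie (Q k) (A (x k))", OF _ lieBA]
      lie.continuous_on[OF contB cont] by (simp flip: b)
  moreover have "magnus A a b - riemann_magnus A M x \<delta> = (integral {a..b} A - Q M)
      - (1 / 2) *\<^sub>R (integral {a..b} (\<lambda>s. lie (B s) (A s)) - (\<Sum>k<M. \<delta> *\<^sub>R lie (Q k) (A (x k))))"
    by (simp add: magnus_def riemann_magnus_def B_def Q_def algebra_simps)
  ultimately have "norm (magnus A a b - riemann_magnus A M x \<delta>)
      \<le> real M * \<delta> * (S * \<delta>) + 1 / 2 * (real M * \<delta> * (4 * (b - a) * \<alpha> * (S * \<delta>)))"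
    by (simp only:) (rule order_trans[OF norm_triangle_ineq4], rule add_mono, auto)
  also have "\<dots> = (b - a)\<^sup>2 / real M * (1 + 2 * (b - a) * \<alpha>) * S"
    using M by (simp add: \<delta>_def field_simps power2_eq_square)
  finally show ?thesis by (simp add: \<delta>_def)
qed

text \<open>One step of telescoping: u and u' are the exact values before and after the step, w the
  Magnus factor, v its quadrature version and p the numerical value before the step.\<close>

lemma norm_diff_mult_le:
  fixes u u' v w p :: "'a::real_normed_algebra"
  shows "norm (u' - v * p) \<le> norm (u' - w * u) + norm (w - v) * norm u + norm v * norm (u - p)"
proof -
  have "u' - v * p = (u' - w * u) + (w - v) * u + v * (u - p)"
    by (simp add: algebra_simps)
  then show ?thesis
    by (simp only:)
      (rule norm_triangle_mono[OF norm_triangle_mono[OF order_refl norm_mult_ineq] norm_mult_ineq])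
qed

section \<open>Unitarity of the propagator and accumulation over all steps\<close>

context star_algebra
begin

lemma skew_riemann_magnus:
  "(\<And>k. k < M \<Longrightarrow> skew (A (x k))) \<Longrightarrow> skew (riemann_magnus A M x \<delta>)"
  unfolding riemann_magnus_def
  by (intro skew_diff skew_scaleR skew_sum skew_lie) auto

text \<open>Since A is skew, the derivative of \<open>star (U t) * U t\<close> vanishes, so this
  product keeps its initial value 1.\<close>

lemma norm_propagator:
  assumes skewA: "\<And>t. t \<in> {0..T} \<Longrightarrow> skew (A t)" and U0: "U 0 = 1"
    and U: "\<And>t. t \<in> {0..T} \<Longrightarrow> (U has_vector_derivative A t * U t) (at t within {0..T})"
    and t: "t \<in> {0..T}"
  shows "norm (U t) = 1"
proof -
  have "((\<lambda>t. star (U t) * U t) has_vector_derivative 0) (at t within {0..T})" if t: "t \<in> {0..T}" for t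
    using has_vector_derivative_mult[OF bounded_linear.has_vector_derivative[OF bounded_linear_star U[OF t]] U[OF t]]
    by (rule has_vector_derivative_eq_rhs) (use skewA[OF t] in \<open>simp add: star_mult skew_def mult.assoc\<close>)
  from has_vector_derivative_zero_constant[OF convex_real_interval(5) this]
  obtain c where "\<And>t. t \<in> {0..T} \<Longrightarrow> star (U t) * U t = c"
    by blast
  from this[of 0] this[of t] show ?thesis
    using t by (intro norm_unitary) (simp add: U0)
qed

text \<open>Both the exact propagator and the numerical factors have norm 1, so earlier errors are
  not amplified and the local errors simply add up.\<close>

theorem magnus_algorithm_error:
  fixes A U :: "real \<Rightarrow> 'a"
  assumes T: "T > 0" and L: "L \<ge> 1" and M: "M \<ge> 1" and \<Delta>t: "\<Delta>t = T / real L"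
    and skewA: "\<And>t. t \<in> {0..T} \<Longrightarrow> skew (A t)"
    and bound: "\<And>t. t \<in> {0..T} \<Longrightarrow> norm (A t) \<le> \<alpha>"
    and lipschitz: "\<And>s t. s \<in> {0..T} \<Longrightarrow> t \<in> {0..T} \<Longrightarrow> norm (A s - A t) \<le> S * \<bar>s - t\<bar>"
    and S: "0 \<le> S"
    and triple: "\<And>j r s t. j < L \<Longrightarrow> r \<in> {grid T L j..grid T L (Suc j)} \<Longrightarrow>
      s \<in> {grid T L j..grid T L (Suc j)} \<Longrightarrow> t \<in> {grid T L j..grid T L (Suc j)} \<Longrightarrow>
      norm (lie (lie (A r) (A s)) (A t)) \<le> \<alpha>c j"
    and quadruple: "\<And>j q r s t. j < L \<Longrightarrow> q \<in> {grid T L j..grid T L (Suc j)} \<Longrightarrow>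
      r \<in> {grid T L j..grid T L (Suc j)} \<Longrightarrow> s \<in> {grid T L j..grid T L (Suc j)} \<Longrightarrow>
      t \<in> {grid T L j..grid T L (Suc j)} \<Longrightarrow>
      norm (lie (lie (A q) (A r)) (lie (A s) (A t))) \<le> \<beta>c j"
    and U0: "U 0 = 1"
    and U: "\<And>t. t \<in> {0..T} \<Longrightarrow> (U has_vector_derivative A t * U t) (at t within {0..T})"
    and \<xi>: "\<And>j. j < L \<Longrightarrow> sample_points M (\<xi> j) (grid T L (Suc j)) (grid T L j)"
    and P0: "P 0 = 1"
    and P: "\<And>j. P (Suc j) = exp (riemann_magnus A M (\<xi> j) ((grid T L (Suc j) - grid T L j) / real M)) * P j"
  shows "norm (U T - P L) \<le> 13 / 24 * \<Delta>t ^ 3 * (\<Sum>j<L. \<alpha>c j) + 5 / 48 * \<Delta>t ^ 4 * (\<Sum>j<L. \<beta>c j)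
    + T * \<Delta>t / real M * (1 + 3 * \<Delta>t * \<alpha>) * S"
proof -
  let ?g = "grid T L"
  have pos: "\<Delta>t > 0" and g: "?g j = real j * \<Delta>t" "?g (Suc j) = ?g j + \<Delta>t" for j
    using T L by (simp_all add: \<Delta>t grid_def field_simps)
  have \<alpha>: "0 \<le> \<alpha>"
    using order_trans[OF norm_ge_zero bound[of 0]] T by simp
  have gL: "?g L = T"
    using L by (simp add: grid_def)
  have sub: "{?g j..?g (Suc j)} \<subseteq> {0..T}" if "j < L" for j
  proof -
    have "?g (Suc j) \<le> ?g L"
      unfolding g(1) using that pos by (intro mult_right_mono) auto
    moreover have "0 \<le> ?g j"
      using pos by (simp add: g(1))
    ultimately show ?thesis unfolding gL by auto
  qed
  have contA: "continuous_on {0..T} A"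
  proof (rule lipschitz_on_continuous_on)
    show "S-lipschitz_on {0..T} A"
      by (rule lipschitz_onI) (auto simp: dist_norm S lipschitz)
  qed
  \<comment> \<open>Quadrature error allotted to one step, with the constant 3 of the final bound
    instead of the 2 proved for one step. L such terms give T * \<Delta>t, as L * \<Delta>t =
    T.\<close>
  define \<epsilon> where "\<epsilon> = \<Delta>t\<^sup>2 / real M * (1 + 3 * \<Delta>t * \<alpha>) * S"
  have "norm (U (?g j) - P j) \<le> 13 / 24 * \<Delta>t ^ 3 * (\<Sum>i<j. \<alpha>c i) + 5 / 48 * \<Delta>t ^ 4 * (\<Sum>i<j. \<beta>c i)
      + real j * \<epsilon>" if "j \<le> L" for j
    using that
  proof (induction j)
    case 0
    then show ?case by (simp add: U0 P0 g)
  next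
    case (Suc j)
    then have j: "j < L" by simp
    note inT = subsetD[OF sub[OF j]]
    let ?I = "{?g j..?g (Suc j)}"
    let ?W = "magnus A (?g j) (?g (Suc j))"
    let ?V = "riemann_magnus A M (\<xi> j) ((?g (Suc j) - ?g j) / real M)"
    have le: "?g j \<le> ?g (Suc j)" and len: "?g (Suc j) - ?g j = \<Delta>t"
      using pos by (simp_all add: g(2))
    have cont: "continuous_on ?I A"
      by (rule continuous_on_subset[OF contA sub[OF j]])
    have U1: "norm (U t) = 1" if "t \<in> ?I" for t
      by (rule norm_propagator[OF skewA U0 U]) (use inT that in auto)
    have xi: "\<xi> j k \<in> ?I" if "k < M" for k
    proof -
      let ?d = "(?g (Suc j) - ?g j) / real M"
      have "0 \<le> ?d"
        using le by simp
      then have "0 \<le> real k * ?d" "real (Suc k) * ?d \<le> real M * ?d"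
        using that by (intro mult_nonneg_nonneg mult_right_mono; simp)+
      then have "?g j \<le> ?g j + real k * ?d" "?g j + real (Suc k) * ?d \<le> ?g j + real M * ?d"
        by (simp_all only: add_le_cancel_left le_add_same_cancel1)
      moreover have "?g j + real M * ?d = ?g (Suc j)"
        using M by simp
      moreover have "\<xi> j k \<in> {?g j + real k * ?d..?g j + real (Suc k) * ?d}"
        using \<xi>[OF j] that unfolding sample_points_def by blast
      ultimately show ?thesis
        unfolding atLeastAtMost_iff by linarith
    qed
    have V: "skew ?V"
      by (intro skew_riemann_magnus skewA inT xi)
    have "norm (U (?g (Suc j)) - exp ?W * U (?g j))
        \<le> 13 / 24 * (?g (Suc j) - ?g j) ^ 3 * \<alpha>c j + 5 / 48 * (?g (Suc j) - ?g j) ^ 4 * \<beta>c j"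
      using U1 inT
      by (intro magnus_step le cont skewA triple[OF j] quadruple[OF j]
          has_vector_derivative_within_subset[OF U sub[OF j]]) auto
    then have step: "norm (U (?g (Suc j)) - exp ?W * U (?g j))
        \<le> 13 / 24 * \<Delta>t ^ 3 * \<alpha>c j + 5 / 48 * \<Delta>t ^ 4 * \<beta>c j"
      unfolding len .
    have "norm (?W - ?V) \<le> (?g (Suc j) - ?g j)\<^sup>2 / real M * (1 + 2 * (?g (Suc j) - ?g j) * \<alpha>) * S"
      by (intro riemann_magnus_error le M cont bound lipschitz S \<xi>[OF j] inT)
    also have "\<dots> \<le> \<epsilon>"
      unfolding \<epsilon>_def len using \<alpha> pos S by (intro mult_right_mono mult_left_mono) auto
    finally have quad: "norm (exp ?W - exp ?V) \<le> \<epsilon>"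
      using norm_exp_diff_le[OF skew_magnus[OF cont skewA[OF inT]] V] by simp
    have Uj: "norm (U (?g j)) = 1"
      using le by (intro U1) simp
    have "norm (U (?g (Suc j)) - P (Suc j)) \<le> norm (U (?g (Suc j)) - exp ?W * U (?g j))
        + norm (exp ?W - exp ?V) * norm (U (?g j)) + norm (exp ?V) * norm (U (?g j) - P j)"
      unfolding P by (rule norm_diff_mult_le)
    also have "\<dots> \<le> 13 / 24 * \<Delta>t ^ 3 * \<alpha>c j + 5 / 48 * \<Delta>t ^ 4 * \<beta>c j + \<epsilon>
        + (13 / 24 * \<Delta>t ^ 3 * (\<Sum>i<j. \<alpha>c i) + 5 / 48 * \<Delta>t ^ 4 * (\<Sum>i<j. \<beta>c i) + real j * \<epsilon>)"
      unfolding norm_exp_skew[OF V] Uj mult_1_left mult_1_right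
      by (rule add_mono[OF add_mono[OF step quad] Suc.IH]) (use j in simp)
    finally show ?case
      unfolding sum.lessThan_Suc of_nat_Suc distrib_left distrib_right by linarith
  qed
  from this[of L] show ?thesis
    unfolding gL \<epsilon>_def using L
    by (simp add: \<Delta>t power2_eq_square)
qed

end

section \<open>Complex matrices with the operator norm\<close>

lemma norm_mult_vec_le_opnorm: "norm (A *v v) \<le> opnorm A * norm v"
  unfolding opnorm_def by (rule onorm[OF matrix_vector_mul_bounded_linear])

lemma opnorm_le: "(\<And>v. norm (A *v v) \<le> e * norm v) \<Longrightarrow> opnorm A \<le> e"
  unfolding opnorm_def by (rule onorm_le)

lemma opnorm_nonneg: "0 \<le> opnorm A"
  unfolding opnorm_def by (rule onorm_pos_le[OF matrix_vector_mul_bounded_linear])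

lemma opnorm_triangle: "opnorm (A + B) \<le> opnorm A + opnorm B"
  by (rule opnorm_le)
    (metis matrix_vector_mult_add_rdistrib distrib_right norm_triangle_mono norm_mult_vec_le_opnorm)

lemma opnorm_mult: "opnorm (A ** B) \<le> opnorm A * opnorm B"
proof (rule opnorm_le)
  fix v
  have "norm (A *v (B *v v)) \<le> opnorm A * norm (B *v v)"
    by (rule norm_mult_vec_le_opnorm)
  also have "\<dots> \<le> opnorm A * (opnorm B * norm v)"
    by (intro mult_left_mono norm_mult_vec_le_opnorm opnorm_nonneg)
  finally show "norm ((A ** B) *v v) \<le> opnorm A * opnorm B * norm v"
    by (simp add: matrix_vector_mul_assoc mult.assoc)
qed

lemma cscale_mult_vec: "cscale c A *v v = (\<chi> i. c * (A *v v) $ i)"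
  by (simp add: vec_eq_iff matrix_vector_mult_def cscale_def sum_distrib_left mult.assoc)

lemma norm_cscale_vec: "norm (\<chi> i. c * (v :: complex^'n) $ i) = cmod c * norm v"
  by (simp add: norm_vec_def norm_mult L2_set_right_distrib)

lemma opnorm_cscale: "opnorm (cscale c A) = cmod c * opnorm A"
  unfolding opnorm_def cscale_mult_vec norm_cscale_vec
proof -
  have "onorm (\<lambda>v. \<chi> i. c * (A *v v) $ i) = onorm (\<lambda>v. cmod c *\<^sub>R (A *v v))"
    by (simp add: onorm_def norm_cscale_vec)
  then show "onorm (\<lambda>v. \<chi> i. c * (A *v v) $ i) = cmod c * onorm ((*v) A)"
    by (simp add: onorm_scaleR[OF matrix_vector_mul_bounded_linear])
qed

lemma scaleR_eq_cscale: "r *\<^sub>R A = cscale (of_real r) A"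
  by (simp add: vec_eq_iff cscale_def scaleR_conv_of_real[where 'a = complex])

text \<open>An entry is a coordinate of the image of a unit vector. This gives definiteness of
  \<open>opnorm\<close> and its comparison with the Frobenius norm.\<close>

lemma norm_component_le_opnorm: "cmod (A $ i $ j) \<le> opnorm A"
proof -
  have "A $ i $ j = (A *v axis j 1) $ i"
    by (simp add: matrix_vector_mult_def axis_def if_distrib cong: if_cong)
  then have "cmod (A $ i $ j) \<le> norm (A *v axis j 1)"
    by (metis Finite_Cartesian_Product.norm_nth_le)
  also have "\<dots> \<le> opnorm A * norm (axis j 1 :: complex^'a)"
    by (rule norm_mult_vec_le_opnorm)
  also have "norm (axis j 1 :: complex^'a) = 1"
    by simp
  finally show ?thesis by simp
qed

lemma opnorm_eq_0: "opnorm A = 0 \<longleftrightarrow> A = 0"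
proof
  assume "opnorm A = 0"
  then have "A $ i $ j = 0" for i j
    using norm_component_le_opnorm[of A i j] by simp
  then show "A = 0" by (simp add: vec_eq_iff)
qed (simp add: opnorm_def onorm_zero)

lemma opnorm_mat_1: "opnorm (mat 1 :: complex^'n^'n) = 1"
proof (rule antisym)
  show "opnorm (mat 1 :: complex^'n^'n) \<le> 1"
    by (rule opnorm_le) simp
  show "1 \<le> opnorm (mat 1 :: complex^'n^'n)"
    \<comment> \<open>\<open>undefined\<close> stands for some index; every diagonal entry is
      1.\<close>
    using norm_component_le_opnorm[of "mat 1" undefined undefined] by (simp add: mat_def)
qed

text \<open>On \<^typ>\<open>complex^'n^'n\<close> the class norm is the Frobenius norm and the class product is
  componentwise, so the Banach algebra of matrices gets a type of its own.\<close>

typedef 'n opmat = "UNIV :: (complex^'n^'n) set"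
  morphisms mat_of op_of ..

declare op_of_inverse [simplified, simp] mat_of_inverse [simp]

lemma opmat_eq_iff: "x = y \<longleftrightarrow> mat_of x = mat_of y"
  by (simp add: mat_of_inject)

instantiation opmat :: (finite) real_normed_algebra_1
begin

definition "0 = op_of 0"
definition "1 = op_of (mat 1)"
definition "x + y = op_of (mat_of x + mat_of y)"
definition "x - y = op_of (mat_of x - mat_of y)"
definition "- x = op_of (- mat_of x)"
definition "x * y = op_of (mat_of x ** mat_of y)"
definition "r *\<^sub>R x = op_of (r *\<^sub>R mat_of x)"
definition "norm x = opnorm (mat_of x)"
definition "sgn x = inverse (norm x) *\<^sub>R (x :: 'a opmat)"
definition "dist x (y :: 'a opmat) = norm (x - y)"
definition "(uniformity :: ('a opmat \<times> 'a opmat) filter) = (INF e\<in>{0<..}. principal {(x, y). dist x y < e})"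
definition "open S \<longleftrightarrow> (\<forall>x\<in>S. \<forall>\<^sub>F (x', y) in uniformity. x' = x \<longrightarrow> y \<in> (S :: 'a opmat set))"

lemma mat_of_simps [simp]:
  "mat_of (0 :: 'a opmat) = 0"
  "mat_of (1 :: 'a opmat) = mat 1"
  "mat_of (x + y) = mat_of x + mat_of (y :: 'a opmat)"
  "mat_of (x - y) = mat_of x - mat_of (y :: 'a opmat)"
  "mat_of (- x) = - mat_of (x :: 'a opmat)"
  "mat_of (x * y) = mat_of x ** mat_of (y :: 'a opmat)"
  "mat_of (r *\<^sub>R x) = r *\<^sub>R mat_of (x :: 'a opmat)"
  by (simp_all add: zero_opmat_def one_opmat_def plus_opmat_def minus_opmat_def uminus_opmat_def
      times_opmat_def scaleR_opmat_def)

instance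
proof
  fix x y z :: "'a opmat" and r s :: real
  show "norm (r *\<^sub>R x) = \<bar>r\<bar> * norm x"
    by (simp add: norm_opmat_def scaleR_eq_cscale opnorm_cscale)
  show "(0 :: 'a opmat) \<noteq> 1"
    using opnorm_mat_1[where 'n = 'a] opnorm_eq_0[of "mat 1 :: complex^'a^'a"] by (auto simp: opmat_eq_iff)
  show "x * y * z = x * (y * z)" "(x + y) * z = x * z + y * z" "x * (y + z) = x * y + x * z"
    by (simp_all add: opmat_eq_iff matrix_mul_assoc matrix_add_ldistrib)
      (simp add: vec_eq_iff matrix_matrix_mult_def distrib_right sum.distrib)
  show "r *\<^sub>R x * y = r *\<^sub>R (x * y)" "x * r *\<^sub>R y = r *\<^sub>R (x * y)"
    by (simp_all add: opmat_eq_iff vec_eq_iff matrix_matrix_mult_def scaleR_sum_right)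
qed (simp_all add: opmat_eq_iff norm_opmat_def opnorm_triangle opnorm_mult opnorm_mat_1
    opnorm_eq_0 algebra_simps sgn_opmat_def dist_opmat_def uniformity_opmat_def open_opmat_def)

end

lemma norm_op_of: "norm (op_of A) = opnorm A"
  by (simp add: norm_opmat_def)

lemma bounded_linear_op_of: "bounded_linear (op_of :: complex^'n^'n \<Rightarrow> 'n::finite opmat)"
  by (subst linear_conv_bounded_linear[symmetric], rule linearI) (simp_all add: opmat_eq_iff)

text \<open>The Frobenius norm is at most the sum of the moduli of all entries, each bounded by the
  operator norm. With continuity of \<open>op_of\<close> the two norms are equivalent, so limits,
  derivatives and series transfer.\<close>

lemma bounded_linear_mat_of: "bounded_linear (mat_of :: 'n::finite opmat \<Rightarrow> complex^'n^'n)"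
proof (rule bounded_linear_intro[where K = "real CARD('n) * real CARD('n)"])
  fix x :: "'n opmat"
  have "norm (mat_of x) \<le> (\<Sum>i\<in>UNIV. norm (mat_of x $ i))"
    unfolding norm_vec_def by (rule L2_set_le_sum) simp
  also have "\<dots> \<le> (\<Sum>i\<in>(UNIV::'n set). \<Sum>j\<in>(UNIV::'n set). norm x)"
  proof (rule sum_mono)
    fix i
    have "norm (mat_of x $ i) \<le> (\<Sum>j\<in>UNIV. norm (mat_of x $ i $ j))"
      unfolding norm_vec_def by (rule L2_set_le_sum) simp
    also have "\<dots> \<le> (\<Sum>j\<in>(UNIV::'n set). norm x)"
      by (intro sum_mono) (simp add: norm_opmat_def norm_component_le_opnorm)
    finally show "norm (mat_of x $ i) \<le> (\<Sum>j\<in>(UNIV::'n set). norm x)" .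
  qed
  finally show "norm (mat_of x) \<le> norm x * (real CARD('n) * real CARD('n))"
    by (simp add: mult_ac)
qed simp_all

instance opmat :: (finite) banach
proof
  fix X :: "nat \<Rightarrow> 'a opmat"
  assume "Cauchy X"
  \<comment> \<open>Completeness is borrowed from the Frobenius norm.\<close>
  then have "convergent (\<lambda>n. mat_of (X n))"
    by (intro Cauchy_convergent bounded_linear.Cauchy[OF bounded_linear_mat_of])
  then obtain L where "(\<lambda>n. mat_of (X n)) \<longlonglongrightarrow> L"
    by (auto simp: convergent_def)
  from bounded_linear.tendsto[OF bounded_linear_op_of this] show "convergent X"
    by (auto simp: convergent_def)
qed

section \<open>Exponential and adjoint of matrices\<close>

lemma mat_of_power: "mat_of (x ^ n) = ((**) (mat_of x) ^^ n) (mat 1)"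
  by (induction n) simp_all

text \<open>The continuous linear map \<open>mat_of\<close> passes through the exponential series;
  this ties \<open>matrix_exp\<close> to the class function \<open>exp\<close>.\<close>

lemma mat_of_exp: "mat_of (exp x) = matrix_exp (mat_of x)"
  unfolding exp_def matrix_exp_def
  by (simp add: bounded_linear.suminf[OF bounded_linear_mat_of summable_exp_generic] mat_of_power
      divide_inverse)

definition adjoint_op :: "'n::finite opmat \<Rightarrow> 'n opmat" where
  "adjoint_op x = op_of (\<chi> i j. cnj (mat_of x $ j $ i))"

text \<open>The real inner product is the real part of the Hermitian one and induces the same norm,
  so it can serve for the C*-identity.\<close>

lemma inner_complex_vec: "v \<bullet> w = Re (\<Sum>i\<in>UNIV. cnj (v $ i) * w $ i)"
  by (simp add: inner_vec_def inner_complex_def)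

lemma inner_adjoint_op: "(mat_of x *v v) \<bullet> w = v \<bullet> (mat_of (adjoint_op x) *v w)"
proof -
  have "(\<Sum>i\<in>UNIV. cnj ((mat_of x *v v) $ i) * w $ i)
      = (\<Sum>i\<in>UNIV. \<Sum>j\<in>UNIV. cnj (mat_of x $ i $ j) * cnj (v $ j) * w $ i)"
    by (simp add: matrix_vector_mult_def sum_distrib_right)
  also have "\<dots> = (\<Sum>j\<in>UNIV. \<Sum>i\<in>UNIV. cnj (mat_of x $ i $ j) * cnj (v $ j) * w $ i)"
    by (rule sum.swap)
  also have "\<dots> = (\<Sum>j\<in>UNIV. cnj (v $ j) * (mat_of (adjoint_op x) *v w) $ j)"
    by (simp add: matrix_vector_mult_def adjoint_op_def sum_distrib_left mult_ac)
  finally show ?thesis by (simp add: inner_complex_vec)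
qed

text \<open>The squared norm of x v is the inner product of v with x* x v; Cauchy-Schwarz does the
  rest.\<close>

lemma norm_square_le_adjoint_op: "(norm x)\<^sup>2 \<le> norm (adjoint_op x * x)"
proof -
  have "norm x \<le> sqrt (norm (adjoint_op x * x))"
    unfolding norm_opmat_def[of x]
  proof (rule opnorm_le)
    fix v
    have "(norm (mat_of x *v v))\<^sup>2 = v \<bullet> (mat_of (adjoint_op x * x) *v v)"
      by (simp add: power2_norm_eq_inner inner_adjoint_op matrix_vector_mul_assoc)
    also have "\<dots> \<le> norm v * norm (mat_of (adjoint_op x * x) *v v)"
      by (rule norm_cauchy_schwarz)
    also have "\<dots> \<le> norm v * (norm (adjoint_op x * x) * norm v)"
      unfolding norm_opmat_def[of "adjoint_op x * x"]
      by (intro mult_left_mono norm_mult_vec_le_opnorm) simp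
    finally have "(norm (mat_of x *v v))\<^sup>2 \<le> (sqrt (norm (adjoint_op x * x)) * norm v)\<^sup>2"
      by (simp add: power2_eq_square mult_ac)
    then show "norm (mat_of x *v v) \<le> sqrt (norm (adjoint_op x * x)) * norm v"
      by (rule power2_le_imp_le) simp
  qed
  then show ?thesis
    using power_mono[of "norm x" _ 2] by fastforce
qed

interpretation opmat: star_algebra adjoint_op
proof
  fix x y :: "'n::finite opmat" and r :: real
  \<comment> \<open>The C*-identity is still the goal here, so the isometry of the adjoint is drawn
    from the inequality just proved.\<close>
  have le: "norm z \<le> norm (adjoint_op z)" for z :: "'n::finite opmat"
  proof (cases "z = 0")
    case False
    have "norm z * norm z \<le> norm (adjoint_op z) * norm z"
      using order_trans[OF norm_square_le_adjoint_op norm_mult_ineq] by (simp add: power2_eq_square)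
    then show ?thesis using False by simp
  qed simp
  show ss: "adjoint_op (adjoint_op z) = z" for z :: "'n::finite opmat"
    by (simp add: adjoint_op_def opmat_eq_iff)
  show "norm (adjoint_op x * x) = (norm x)\<^sup>2"
  proof (rule antisym)
    have "norm (adjoint_op x * x) \<le> norm (adjoint_op x) * norm x"
      by (rule norm_mult_ineq)
    also have "norm (adjoint_op x) = norm x"
      using le[of x] le[of "adjoint_op x"] by (simp add: ss)
    finally show "norm (adjoint_op x * x) \<le> (norm x)\<^sup>2"
      by (simp add: power2_eq_square)
  qed (rule norm_square_le_adjoint_op)
qed (simp_all add: adjoint_op_def opmat_eq_iff vec_eq_iff matrix_matrix_mult_def mult.commute)

section \<open>Passage from the Hamiltonian H to A = -iH\<close>

lemma lie_op_of: "lie (op_of A) (op_of B) = op_of (commutator A B)"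
  by (simp add: lie_def commutator_def opmat_eq_iff)

lemma commutator_cscale: "commutator (cscale c A) (cscale d B) = cscale (c * d) (commutator A B)"
  by (simp add: commutator_def cscale_def vec_eq_iff matrix_matrix_mult_def sum_distrib_left
      right_diff_distrib mult_ac)

definition generator :: "complex^'n^'n \<Rightarrow> 'n::finite opmat" where
  "generator X = op_of (cscale (- \<i>) X)"

lemma bounded_linear_generator: "bounded_linear (generator :: _ \<Rightarrow> 'n::finite opmat)"
  by (subst linear_conv_bounded_linear[symmetric], rule linearI)
    (simp_all add: generator_def opmat_eq_iff cscale_def vec_eq_iff algebra_simps)

lemma norm_generator: "norm (generator X) = opnorm X"
  by (simp add: generator_def norm_op_of opnorm_cscale)

lemma skew_generator:
  assumes "hermitian X"
  shows "opmat.skew (generator X)"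
proof -
  have "cnj (X $ j $ i) = X $ i $ j" for i j
    by (rule sym) (use assms in \<open>unfold hermitian_def, blast\<close>)
  then show ?thesis
    unfolding opmat.skew_def generator_def adjoint_op_def
    by (simp add: opmat_eq_iff vec_eq_iff cscale_def)
qed

lemma generator_mult: "generator X * op_of Y = op_of (cscale (- \<i>) (X ** Y))"
  by (simp add: generator_def opmat_eq_iff vec_eq_iff cscale_def matrix_matrix_mult_def
      sum_distrib_left mult.assoc sum_negf)

lemma lie_generator: "lie (generator X) (generator Y) = - op_of (commutator X Y)"
  by (simp add: generator_def lie_op_of commutator_cscale)
    (simp add: opmat_eq_iff vec_eq_iff cscale_def)

text \<open>The factors -i only contribute a phase of modulus 1.\<close>

lemma norm_lie_generator_triple:
  "norm (lie (lie (generator X) (generator Y)) (generator Z)) = opnorm (commutator (commutator X Y) Z)"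
  by (simp add: generator_def lie_op_of commutator_cscale norm_op_of opnorm_cscale norm_mult)

lemma norm_lie_generator_quadruple:
  "norm (lie (lie (generator X) (generator Y)) (lie (generator Z) (generator W)))
    = opnorm (commutator (commutator X Y) (commutator Z W))"
  by (simp add: generator_def lie_op_of commutator_cscale norm_op_of opnorm_cscale norm_mult)

text \<open>The minus sign of \<open>lie_generator\<close> turns the -1/2 of
  \<open>riemann_magnus\<close> into the +1/2 of \<open>riemann_magnus2\<close>.\<close>

lemma riemann_magnus_generator:
  "riemann_magnus (\<lambda>t. generator (H t)) M x ((b - a) / real M) = op_of (riemann_magnus2 H M x b a)"
proof -
  interpret generator: bounded_linear "generator :: _ \<Rightarrow> 'a opmat"
    by (rule bounded_linear_generator)
  interpret op: bounded_linear "op_of :: complex^'a^'a \<Rightarrow> 'a opmat"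
    by (rule bounded_linear_op_of)
  show ?thesis
    by (simp add: riemann_magnus_def riemann_magnus2_def Let_def op.add op.scaleR op.sum
        lie_generator sum_negf flip: generator.scaleR generator.sum generator_def)
qed

theorem theorem3:
  fixes H U :: "real \<Rightarrow> complex^'n^'n"
    and T \<alpha> \<Delta>t :: real
    and L M :: nat
    and \<alpha>comm \<beta>comm :: "nat \<Rightarrow> real"
    and \<xi> :: "nat \<Rightarrow> nat \<Rightarrow> real"
  assumes "T > 0" and "L \<ge> 1" and "M \<ge> 1"
    and "\<Delta>t = T / real L"
    and "\<And>t. t \<in> {0..T} \<Longrightarrow> hermitian (H t)"
    and "H differentiable_on {0..T}"
    and "\<And>t. t \<in> {0..T} \<Longrightarrow> opnorm (H t) \<le> \<alpha>"
    and "\<And>j \<sigma> s t. j < L \<Longrightarrow>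
           \<sigma> \<in> {grid T L j..grid T L (Suc j)} \<Longrightarrow>
           s \<in> {grid T L j..grid T L (Suc j)} \<Longrightarrow>
           t \<in> {grid T L j..grid T L (Suc j)} \<Longrightarrow>
           opnorm (commutator (commutator (H \<sigma>) (H s)) (H t)) \<le> \<alpha>comm j"
    and "\<And>j \<sigma> s t \<tau>. j < L \<Longrightarrow>
           \<sigma> \<in> {grid T L j..grid T L (Suc j)} \<Longrightarrow>
           s \<in> {grid T L j..grid T L (Suc j)} \<Longrightarrow>
           t \<in> {grid T L j..grid T L (Suc j)} \<Longrightarrow>
           \<tau> \<in> {grid T L j..grid T L (Suc j)} \<Longrightarrow>
           opnorm (commutator (commutator (H \<sigma>) (H s)) (commutator (H \<tau>) (H t))) \<le> \<beta>comm j"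
    and "is_time_ordered_exp H T U"
    and "\<And>j. j < L \<Longrightarrow> sample_points M (\<xi> j) (grid T L (Suc j)) (grid T L j)"
  shows "ereal (opnorm (U T - magnus_algorithm H T L M \<xi>))
    \<le> ereal (13 / 24 * \<Delta>t ^ 3 * (\<Sum>j<L. \<alpha>comm j))
      + ereal (5 / 48 * \<Delta>t ^ 4 * (\<Sum>j<L. \<beta>comm j))
      + ereal (T * \<Delta>t / real M * (1 + 3 * \<Delta>t * \<alpha>))
        * (SUP s\<in>{0..T}. ereal (opnorm (vector_derivative H (at s within {0..T}))))"
proof -
  \<comment> \<open>The derivative of a differentiable H may be unbounded, so the supremum is taken
    in the extended reals and may be infinite.\<close>
  define S where "S = (SUP s\<in>{0..T}. ereal (opnorm (vector_derivative H (at s within {0..T}))))"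
  have S_upper: "ereal (opnorm (vector_derivative H (at s within {0..T}))) \<le> S" if "s \<in> {0..T}" for s
    unfolding S_def using that by (rule SUP_upper)
  have "0 \<le> S"
    using \<open>T > 0\<close> by (intro order_trans[OF _ S_upper[of 0]]) (simp_all add: opnorm_nonneg)
  then consider "S = \<infinity>" | r where "S = ereal r" "0 \<le> r"
    by (cases S) auto
  then show ?thesis
  proof cases
    case 1
    have "0 \<le> \<alpha>"
      using order_trans[OF opnorm_nonneg assms(7)[of 0]] \<open>T > 0\<close> by simp
    \<comment> \<open>Strict positivity matters: in the extended reals 0 times infinity is 0,
      whereas a positive coefficient makes the right-hand side infinite.\<close>
    then have "T * \<Delta>t / real M * (1 + 3 * \<Delta>t * \<alpha>) > 0"
      using assms(1-4) by (intro mult_pos_pos divide_pos_pos add_pos_nonneg) auto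
    moreover have "ereal c * \<infinity> = \<infinity>" if "c > 0" for c
      using that by simp
    ultimately show ?thesis
      unfolding S_def[symmetric] 1 by (simp only:) simp
  next
    case 2
    define A where "A t = generator (H t)" for t
    define V where "V t = op_of (U t)" for t
    \<comment> \<open>The partial products of the algorithm; \<open>ordered_prod\<close> puts the
      newest factor on the left, as the recursion for P demands.\<close>
    define P where "P j = op_of (ordered_prod
      (\<lambda>j. matrix_exp (riemann_magnus2 H M (\<xi> j) (grid T L (Suc j)) (grid T L j))) j)" for j
    have dA: "(A has_vector_derivative generator (vector_derivative H (at t within {0..T})))
        (at t within {0..T})" if "t \<in> {0..T}" for t
      unfolding A_def[abs_def] using assms(6) that
      by (intro bounded_linear.has_vector_derivative[OF bounded_linear_generator])
        (simp add: differentiable_on_def vector_derivative_works)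
    \<comment> \<open>The mean value inequality, applied in the operator norm, turns the derivative
      bound r into a Lipschitz constant.\<close>
    have lipschitz: "norm (A s - A t) \<le> r * \<bar>s - t\<bar>" if "s \<in> {0..T}" "t \<in> {0..T}" for s t
    proof -
      have "norm (A s - A t) \<le> r * norm (s - t)"
      proof (rule differentiable_bound[OF convex_real_interval(5)])
        fix u assume u: "u \<in> {0..T}"
        show "(A has_derivative (\<lambda>h. h *\<^sub>R generator (vector_derivative H (at u within {0..T}))))
            (at u within {0..T})"
          using dA[OF u] by (simp add: has_vector_derivative_def)
        show "onorm (\<lambda>h. h *\<^sub>R generator (vector_derivative H (at u within {0..T}))) \<le> r"
          using S_upper[OF u] 2
          by (intro onorm_le) (simp add: norm_generator mult.commute[of r] mult_left_mono)
      qed (use that in auto)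
      then show ?thesis by simp
    qed
    have "norm (V T - P L) \<le> 13 / 24 * \<Delta>t ^ 3 * (\<Sum>j<L. \<alpha>comm j) + 5 / 48 * \<Delta>t ^ 4 * (\<Sum>j<L. \<beta>comm j)
      + T * \<Delta>t / real M * (1 + 3 * \<Delta>t * \<alpha>) * r"
    proof (rule opmat.magnus_algorithm_error[OF assms(1-4), where A = A and \<xi> = \<xi>])
      show "(V has_vector_derivative A t * V t) (at t within {0..T})" if "t \<in> {0..T}" for t
        unfolding V_def[abs_def] A_def generator_mult using assms(10) that
        by (intro bounded_linear.has_vector_derivative[OF bounded_linear_op_of])
          (simp add: is_time_ordered_exp_def)
      show "P (Suc j) = exp (riemann_magnus A M (\<xi> j) ((grid T L (Suc j) - grid T L j) / real M)) * P j" for j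
        unfolding A_def[abs_def] riemann_magnus_generator P_def
        by (simp add: opmat_eq_iff mat_of_exp)
    qed (use assms 2 lipschitz in \<open>auto simp: A_def V_def P_def norm_generator skew_generator
          norm_lie_generator_triple norm_lie_generator_quadruple is_time_ordered_exp_def one_opmat_def\<close>)
    moreover have "norm (V T - P L) = opnorm (U T - magnus_algorithm H T L M \<xi>)"
      by (simp add: norm_opmat_def V_def P_def magnus_algorithm_def)
    ultimately show ?thesis
      unfolding S_def[symmetric] 2 by simp
  qed
qed

end
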